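(* Let $F$ be R. Thompson's group, let $K$ be a field and let $R=K[F]$ be the group ring of $F$ over $K$. Define $$u_0=(1+x_0-x_1)(1-x_3),$$ and for $k\ge1$ $$u_k=(1-x_1)\phi(u_{k-1})=(1-x_1)(1-x_2)\cdots(1-x_k)(1+x_k-x_{k+1})(1-x_{k+3}).$$ Then for any solution $(u,v)\in R^2$ of the equation $(1-x_0)u=(1-x_1)v$, the element $u$ belongs to the right $R$-module generated by $u_0,u_1,u_2,\ldots$. Moreover, for any solution $(u,v)$ of this equation in the monoid ring $K[M]$, one can express $u$ as $u=u_0r_0+u_1r_1+\cdots+u_kr_k$ for some $k\ge 0$ and some elements $r_i\in K[M_i]$ $(0\le i\le k)$.
   Context: $M$ is the monoid given by the presentation $\langle x_0,x_1,x_2,\ldots \mid x_jx_i=x_ix_{j+1}\ (0\le i<j)\rangle$, and R. Thompson's group $F$ is the group given by the same presentation; $M$ embeds naturally in $F$ (which is its group of right quotients), so $K[M]\subset K[F]$. For $i\ge0$, $M_i$ denotes the submonoid of $M$ generated by $x_i,x_{i+1},\ldots$. $\phi$ is the shift endomorphism of $F$ (and its $K$-linear extension to $K[F]$) taking $x_i$ to $x_{i+1}$ for all $i\ge0$. *)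

theory Defs
  imports Main "HOL.Hull" "HOL-Library.Poly_Mapping"
begin

section \<open>Monoid and group presentations\<close>

text \<open>The least monoid congruence on the free monoid of words that contains the defining
  relations \<open>R\<close>.\<close>

inductive pres_eq :: "('g list \<Rightarrow> 'g list \<Rightarrow> bool) \<Rightarrow> 'g list \<Rightarrow> 'g list \<Rightarrow> bool"
  for R :: "'g list \<Rightarrow> 'g list \<Rightarrow> bool"
where
  pres_rel: "R v w \<Longrightarrow> pres_eq R v w"
| pres_refl: "pres_eq R w w"
| pres_sym: "pres_eq R v w \<Longrightarrow> pres_eq R w v"
| pres_trans: "pres_eq R u v \<Longrightarrow> pres_eq R v w \<Longrightarrow> pres_eq R u w"
| pres_append: "pres_eq R v v' \<Longrightarrow> pres_eq R w w' \<Longrightarrow> pres_eq R (v @ w) (v' @ w')"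

lemma equivp_pres_eq: "equivp (pres_eq R)"
  by (intro equivpI reflpI sympI transpI) (blast intro: pres_eq.intros)+

inductive thompson_rel :: "nat list \<Rightarrow> nat list \<Rightarrow> bool" where
  "i < j \<Longrightarrow> thompson_rel [j, i] [i, Suc j]"

text \<open>The letter \<open>(i, True)\<close> stands for the generator with index \<open>i\<close>, and \<open>(i, False)\<close> for its
  formal inverse.\<close>

inductive thompson_group_rel :: "(nat \<times> bool) list \<Rightarrow> (nat \<times> bool) list \<Rightarrow> bool" where
  group_rel: "thompson_rel v w \<Longrightarrow>
    thompson_group_rel (map (\<lambda>i. (i, True)) v) (map (\<lambda>i. (i, True)) w)"
| group_cancel: "thompson_group_rel [(i, b), (i, \<not> b)] []"


section \<open>The monoid $M$ and Thompson's group $F$\<close>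

text \<open>The (noncommutative) products of $M$ and $F$ are written additively, because the convolution
  product on \<^typ>\<open>'a \<Rightarrow>\<^sub>0 'b\<close> is defined in the library for \<^class>\<open>monoid_add\<close>.  In the
  resulting monoid rings the product is written multiplicatively.\<close>

quotient_type thompson_monoid = "nat list" / "pres_eq thompson_rel"
  by (rule equivp_pres_eq)

quotient_type thompson_group = "(nat \<times> bool) list" / "pres_eq thompson_group_rel"
  by (rule equivp_pres_eq)

instantiation thompson_monoid :: monoid_add
begin

lift_definition zero_thompson_monoid :: thompson_monoid is "[]" .

lift_definition plus_thompson_monoid :: "thompson_monoid \<Rightarrow> thompson_monoid \<Rightarrow> thompson_monoid"
  is "(@)" by (rule pres_append)

instance
  by standard (transfer, simp add: pres_refl)+

end

lemma pres_eq_inverse_word: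
  assumes "pres_eq thompson_group_rel v w"
  shows "pres_eq thompson_group_rel (rev (map (\<lambda>(i, b). (i, \<not> b)) v)) (rev (map (\<lambda>(i, b). (i, \<not> b)) w))"
  using assms
proof induction
  case (pres_rel v w)
  then show ?case
  proof cases
    case (group_rel v' w')
    from group_rel(3) obtain i j where "i < j" and vw: "v' = [j, i]" "w' = [i, Suc j]"
      by cases
    let ?E = "pres_eq thompson_group_rel"
    let ?p = "\<lambda>i. (i, True)" and ?n = "\<lambda>i. (i, False)"
    have canc: "?E (x @ [(k, b), (k, \<not> b)] @ y) (x @ y)" for x y k b
      using pres_append[OF pres_refl[of _ x] pres_append[OF pres_eq.pres_rel[where R = thompson_group_rel, OF group_cancel[of k b]] pres_refl[of _ y]]]
      by simp
    have r: "?E (x @ [?p j, ?p i] @ y) (x @ [?p i, ?p (Suc j)] @ y)" for x y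
    proof -
      have "thompson_group_rel (map ?p [j, i]) (map ?p [i, Suc j])"
        using \<open>i < j\<close> by (intro thompson_group_rel.group_rel thompson_rel.intros)
      then have "?E [?p j, ?p i] [?p i, ?p (Suc j)]"
        by (auto intro: pres_eq.pres_rel)
      then show ?thesis
        by (intro pres_append pres_refl)
    qed
    note [trans] = pres_trans
    have "?E [?n i, ?n j] ([?n i, ?n j] @ [?p i, ?p (Suc j)] @ [?n (Suc j), ?n i])"
      using canc[of "[?n i, ?n j, ?p i]" "Suc j" True "[?n i]"] canc[of "[?n i, ?n j]" i True "[]"]
      by (auto intro: pres_sym pres_trans)
    also have "?E \<dots> ([?n i, ?n j] @ [?p j, ?p i] @ [?n (Suc j), ?n i])"
      by (rule pres_sym[OF r])
    also have "?E \<dots> [?n (Suc j), ?n i]"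
      using canc[of "[?n i]" j False "[?p i, ?n (Suc j), ?n i]"] canc[of "[]" i False "[?n (Suc j), ?n i]"]
      by (auto intro: pres_trans)
    finally show ?thesis
      using group_rel vw by simp
  next
    case (group_cancel i b)
    then show ?thesis
      using pres_eq.pres_rel[where R = thompson_group_rel, OF thompson_group_rel.group_cancel[of i b]] by simp
  qed
qed (auto intro: pres_eq.intros)

lemma pres_eq_inverse_cancel:
  "pres_eq thompson_group_rel (rev (map (\<lambda>(i, b). (i, \<not> b)) w) @ w) []"
proof (induction w)
  case Nil
  then show ?case by (simp add: pres_refl)
next
  case (Cons a w)
  obtain i b where a: "a = (i, b)" by force
  let ?r = "rev (map (\<lambda>(i, b). (i, \<not> b)) w)"
  have "pres_eq thompson_group_rel (?r @ [(i, \<not> b), (i, \<not> \<not> b)] @ w) (?r @ [] @ w)"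
    by (intro pres_append pres_refl pres_eq.pres_rel group_cancel)
  with Cons show ?case
    by (auto simp: a intro: pres_trans)
qed

instantiation thompson_group :: group_add
begin

lift_definition zero_thompson_group :: thompson_group is "[]" .

lift_definition plus_thompson_group :: "thompson_group \<Rightarrow> thompson_group \<Rightarrow> thompson_group"
  is "(@)" by (rule pres_append)

lift_definition uminus_thompson_group :: "thompson_group \<Rightarrow> thompson_group"
  is "\<lambda>w. rev (map (\<lambda>(i, b). (i, \<not> b)) w)" by (rule pres_eq_inverse_word)

definition minus_thompson_group :: "thompson_group \<Rightarrow> thompson_group \<Rightarrow> thompson_group"
  where "minus_thompson_group g h = g + - h"

instance
proof
  fix a b c :: thompson_group
  show "a + b + c = a + (b + c)" by transfer (simp add: pres_refl)
  show "0 + a = a" by transfer (simp add: pres_refl)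
  show "a + 0 = a" by transfer (simp add: pres_refl)
  show "- a + a = 0" by transfer (rule pres_eq_inverse_cancel)
  show "a + - b = a - b" by (simp add: minus_thompson_group_def)
qed

end

lift_definition gen_M :: "nat \<Rightarrow> thompson_monoid" is "\<lambda>i. [i]" .

lift_definition gen_F :: "nat \<Rightarrow> thompson_group" is "\<lambda>i. [(i, True)]" .

lift_definition embed_MF :: "thompson_monoid \<Rightarrow> thompson_group" is "map (\<lambda>i. (i, True))"
proof -
  fix v w
  assume "pres_eq thompson_rel v w"
  then show "pres_eq thompson_group_rel (map (\<lambda>i. (i, True)) v) (map (\<lambda>i. (i, True)) w)"
    by induction (auto intro: pres_eq.intros group_rel)
qed

lift_definition shift_F :: "thompson_group \<Rightarrow> thompson_group" is "map (\<lambda>(i, b). (Suc i, b))"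
proof -
  let ?s = "map (\<lambda>(i, b). (Suc i, b)) :: (nat \<times> bool) list \<Rightarrow> _"
  fix v w
  assume "pres_eq thompson_group_rel v w"
  then show "pres_eq thompson_group_rel (?s v) (?s w)"
  proof induction
    case (pres_rel v w)
    then show ?case
    proof cases
      case (group_rel v' w')
      from group_rel(3) obtain i j where "i < j" "v' = [j, i]" "w' = [i, Suc j]"
        by cases
      then have "thompson_rel (map Suc v') (map Suc w')"
        by (simp add: thompson_rel.intros)
      then have "pres_eq thompson_group_rel (map (\<lambda>i. (i, True)) (map Suc v')) (map (\<lambda>i. (i, True)) (map Suc w'))"
        by (intro pres_eq.pres_rel thompson_group_rel.group_rel)
      then show ?thesis
        using group_rel by (simp add: comp_def)
    qed (auto intro: pres_eq.pres_rel group_cancel)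
  qed (auto intro: pres_eq.intros)
qed

lemma embed_MF_gen [simp]: "embed_MF (gen_M i) = gen_F i"
  by transfer (simp add: pres_refl)

lemma embed_MF_zero [simp]: "embed_MF 0 = 0"
  by transfer (simp add: pres_refl)

lemma embed_MF_plus [simp]: "embed_MF (a + b) = embed_MF a + embed_MF b"
  by transfer (simp add: pres_refl)

lemma gen_M_rel: "i < j \<Longrightarrow> gen_M j + gen_M i = gen_M i + gen_M (Suc j)"
  by transfer (simp add: pres_rel thompson_rel.intros)

lemma gen_F_rel: "i < j \<Longrightarrow> gen_F j + gen_F i = gen_F i + gen_F (Suc j)"
  by (metis embed_MF_gen embed_MF_plus gen_M_rel)

lemma shift_F_gen [simp]: "shift_F (gen_F i) = gen_F (Suc i)"
  by transfer (simp add: pres_refl)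

lemma shift_F_zero [simp]: "shift_F 0 = 0"
  by transfer (simp add: pres_refl)

lemma shift_F_plus [simp]: "shift_F (a + b) = shift_F a + shift_F b"
  by transfer (simp add: pres_refl)

definition submonoid :: "'a::monoid_add set \<Rightarrow> bool" where
  "submonoid S \<longleftrightarrow> 0 \<in> S \<and> (\<forall>a\<in>S. \<forall>b\<in>S. a + b \<in> S)"

definition tail_submonoid :: "nat \<Rightarrow> thompson_monoid set" where
  "tail_submonoid i = submonoid hull {gen_M j | j. i \<le> j}"


section \<open>The group ring $K[F]$\<close>

type_synonym 'k thompson_ring = "thompson_group \<Rightarrow>\<^sub>0 'k"

definition X :: "nat \<Rightarrow> 'k::field thompson_ring" where
  "X i = Poly_Mapping.single (gen_F i) 1"

text \<open>For a submonoid \<open>S\<close> of $M$, the monoid ring $K[S]$ as a subset of $K[F]$, with $M$ regarded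
  as a submonoid of $F$ through the natural map.\<close>

definition monoid_subring :: "thompson_monoid set \<Rightarrow> 'k::field thompson_ring set" where
  "monoid_subring S = {a. Poly_Mapping.keys a \<subseteq> embed_MF ` S}"

definition shift_KF :: "'k::field thompson_ring \<Rightarrow> 'k thompson_ring" where
  "shift_KF a = (\<Sum>g\<in>Poly_Mapping.keys a. Poly_Mapping.single (shift_F g) (Poly_Mapping.lookup a g))"

primrec u_elem :: "nat \<Rightarrow> 'k::field thompson_ring" where
  "u_elem 0 = (1 + X 0 - X 1) * (1 - X 3)"
| "u_elem (Suc k) = (1 - X 1) * shift_KF (u_elem k)"

definition right_submodule :: "'r::ring_1 set \<Rightarrow> bool" where
  "right_submodule I \<longleftrightarrow> 0 \<in> I \<and> (\<forall>a\<in>I. \<forall>b\<in>I. a + b \<in> I) \<and> (\<forall>a\<in>I. \<forall>r. a * r \<in> I)"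

definition right_module_generated :: "'r::ring_1 set \<Rightarrow> 'r set" where
  "right_module_generated S = right_submodule hull S"


subsection \<open>The closed form of the elements $u_k$\<close>

lemma shift_KF_superset:
  assumes "finite A" "Poly_Mapping.keys a \<subseteq> A"
  shows "shift_KF a = (\<Sum>g\<in>A. Poly_Mapping.single (shift_F g) (Poly_Mapping.lookup a g))"
  unfolding shift_KF_def using assms
  by (intro sum.mono_neutral_left) (auto simp: in_keys_iff)

lemma shift_KF_add: "shift_KF (a + b) = shift_KF a + shift_KF b"
proof -
  let ?A = "Poly_Mapping.keys a \<union> Poly_Mapping.keys b"
  have "Poly_Mapping.keys (a + b) \<subseteq> ?A" by (rule keys_add)
  then show ?thesis
    by (simp add: shift_KF_superset[of ?A] lookup_add single_add sum.distrib)
qed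

lemma shift_KF_zero [simp]: "shift_KF 0 = 0"
  by (simp add: shift_KF_def)

lemma shift_KF_single [simp]: "shift_KF (Poly_Mapping.single g c) = Poly_Mapping.single (shift_F g) c"
  by (simp add: shift_KF_superset[of "{g}"])

lemma shift_KF_one [simp]: "shift_KF 1 = 1"
  using shift_KF_single[of 0 1] by simp

lemma shift_KF_X [simp]: "shift_KF (X i) = X (Suc i)"
  by (simp add: X_def)

lemma shift_KF_diff: "shift_KF (a - b) = shift_KF a - shift_KF b"
  using shift_KF_add[of "a - b" b] by (simp add: algebra_simps)

lemma shift_KF_sum: "shift_KF (sum f A) = (\<Sum>x\<in>A. shift_KF (f x))"
  by (induction A rule: infinite_finite_induct) (auto simp: shift_KF_add)

lemma poly_mapping_eq_sum_single:
  "a = (\<Sum>g\<in>Poly_Mapping.keys a. Poly_Mapping.single g (Poly_Mapping.lookup a g))"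
  by (rule poly_mapping_eqI) (auto simp: lookup_sum lookup_single when_def in_keys_iff sum.delta)

lemma shift_KF_mult: "shift_KF (a * b) = shift_KF a * shift_KF b"
proof -
  let ?s = "\<lambda>a g. Poly_Mapping.single g (Poly_Mapping.lookup a g)"
  have "a * b = (\<Sum>g\<in>Poly_Mapping.keys a. ?s a g) * (\<Sum>h\<in>Poly_Mapping.keys b. ?s b h)"
    using poly_mapping_eq_sum_single[of a] poly_mapping_eq_sum_single[of b] by simp
  then show ?thesis
    by (simp add: sum_product mult_single shift_KF_sum)
      (simp add: shift_KF_def sum_product mult_single)
qed

lemma shift_KF_prod_list: "shift_KF (prod_list as) = prod_list (map shift_KF as)"
  by (induction as) (auto simp: shift_KF_mult)

lemma u_elem_closed_form:
  "u_elem k = (\<Prod>i\<leftarrow>[1..<Suc k]. 1 - X i) * (1 + X k - X (k + 1)) * (1 - X (k + 3))"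
proof (induction k)
  case 0
  then show ?case by simp
next
  case (Suc k)
  have "[1..<Suc (Suc k)] = 1 # map Suc [1..<Suc k]"
    by (simp add: map_Suc_upt upt_conv_Cons)
  then show ?case
    by (simp add: Suc shift_KF_mult shift_KF_prod_list shift_KF_diff shift_KF_add comp_def
        mult.assoc del: upt_Suc)
qed

end

(* For a in K[M_1] one has a x_0 = x_0 phi(a), so K[M] is a skew polynomial ring in x_0 over K[M_1],
   and the equation can be read off degree by degree in x_0.  If u has x_0-degree N >= 1, its leading
   component is forced to be x_0 (1 - x_3) c, which is also the leading component of u_0 c, and
   u - u_0 c is again a solution.  If u has x_0-degree 0, then u = (1 - x_1) phi(w), where w is again
   a solution, of smaller length; the induction hypothesis for w is shifted by phi.  Undoing the shift
   needs phi to be injective on M, which follows from a piecewise linear action of F on the real line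
   that separates normal forms.  A solution in K[F] is moved into K[M] by a common right denominator,
   which exists because M has common right multiples. *)

theory Submission
  imports Complex_Main Defs
begin

section \<open>Positive elements of $F$\<close>

lemma thompson_monoid_induct:
  assumes "Q 0" and "\<And>i m. Q m \<Longrightarrow> Q (gen_M i + m)"
  shows "Q m"
proof (induction m rule: thompson_monoid.abs_induct)
  case (1 w)
  show ?case
  proof (induction w)
    case Nil
    then show ?case using assms(1) by (simp add: zero_thompson_monoid_def)
  next
    case (Cons i w)
    from assms(2)[OF this, of i] show ?case
      by (simp add: gen_M.abs_eq plus_thompson_monoid.abs_eq)
  qed
qed

lemma thompson_group_induct [case_names zero gen inverse_gen]:
  assumes "Q 0" and "\<And>i g. Q g \<Longrightarrow> Q (gen_F i + g)" and "\<And>i g. Q g \<Longrightarrow> Q (- gen_F i + g)"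
  shows "Q g"
proof (induction g rule: thompson_group.abs_induct)
  case (1 w)
  show ?case
  proof (induction w)
    case Nil
    then show ?case using assms(1) by (simp add: zero_thompson_group_def)
  next
    case (Cons a w)
    obtain i b where a: "a = (i, b)" by force
    show ?case
      using assms(2)[OF Cons, of i] assms(3)[OF Cons, of i] a
      by (cases b) (simp_all add: gen_F.abs_eq plus_thompson_group.abs_eq uminus_thompson_group.abs_eq)
  qed
qed

abbreviation positive :: "thompson_group set" where
  "positive \<equiv> range embed_MF"

lemma positive_zero: "0 \<in> positive"
  by (metis embed_MF_zero rangeI)

lemma positive_gen: "gen_F i \<in> positive"
  by (metis embed_MF_gen rangeI)

lemma positive_add: "g \<in> positive \<Longrightarrow> h \<in> positive \<Longrightarrow> g + h \<in> positive"
  by (metis (no_types, lifting) embed_MF_plus imageE rangeI)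

lemma positive_induct [consumes 1, case_names zero gen]:
  assumes "g \<in> positive" "Q 0" "\<And>i h. h \<in> positive \<Longrightarrow> Q h \<Longrightarrow> Q (gen_F i + h)"
  shows "Q g"
proof -
  have "Q (embed_MF m)" for m
    by (induction m rule: thompson_monoid_induct) (use assms(2,3) in auto)
  with assms(1) show ?thesis by auto
qed

lemma shift_F_minus: "shift_F (- g) = - shift_F g"
  by (metis add_eq_0_iff minus_add_cancel neg_eq_iff_add_eq_0 shift_F_plus shift_F_zero)

text \<open>A letter x_0 anywhere in a positive word can be moved to the front by x_j x_0 = x_0
  x_{j+1}; a word without x_0 is a shift.\<close>

lemma positive_cases:
  assumes "g \<in> positive"
  obtains h where "h \<in> positive" "g = gen_F 0 + h" | h where "h \<in> positive" "g = shift_F h"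
proof -
  have "(\<exists>h\<in>positive. g = gen_F 0 + h) \<or> (\<exists>h\<in>positive. g = shift_F h)"
    using assms
  proof (induction rule: positive_induct)
    case zero
    then show ?case by (metis positive_zero shift_F_zero)
  next
    case (gen i g)
    show ?case
    proof (cases i)
      case 0
      then show ?thesis using gen by blast
    next
      case (Suc j)
      from gen(2) show ?thesis
      proof
        assume "\<exists>h\<in>positive. g = gen_F 0 + h"
        then obtain h where h: "h \<in> positive" "g = gen_F 0 + h" by blast
        then have "gen_F i + g = gen_F 0 + (gen_F (Suc i) + h)"
          using gen_F_rel[of 0 i] Suc by (simp add: add.assoc[symmetric])
        then show ?thesis using h by (blast intro: positive_add positive_gen)
      next
        assume "\<exists>h\<in>positive. g = shift_F h"
        then obtain h where h: "h \<in> positive" "g = shift_F h" by blast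
        then have "gen_F i + g = shift_F (gen_F j + h)"
          by (simp add: Suc)
        then show ?thesis using h by (blast intro: positive_add positive_gen)
      qed
    qed
  qed
  then show ?thesis using that by blast
qed

section \<open>Common right multiples and right denominators\<close>

lemma positive_common_right_multiple:
  assumes "g \<in> positive"
  shows "\<exists>m\<in>positive. \<exists>h\<in>positive. g + m = gen_F i + h"
  using assms
proof (induction arbitrary: i rule: positive_induct)
  case zero
  then show ?case by (metis add_0_left add_0_right positive_gen positive_zero)
next
  case (gen j g)
  consider "i = j" | "i < j" | "j < i" by linarith
  then show ?case
  proof cases
    case 1
    then show ?thesis using gen by (metis add_0_right positive_zero)
  next
    case 2
    obtain m h where *: "m \<in> positive" "h \<in> positive" "g + m = gen_F i + h"
      using gen(2) by blast
    have "gen_F j + g + m = gen_F i + (gen_F (Suc j) + h)"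
      using * gen_F_rel[OF 2] by (simp add: add.assoc) (simp add: add.assoc[symmetric])
    then show ?thesis using * by (blast intro: positive_add positive_gen)
  next
    case 3
    \<comment> \<open>Here x_i x_j = x_j x_{i+1}, so \<open>g\<close> has to be completed to a right
      multiple of x_{i+1}; this is why the induction runs over all i at once.\<close>
    obtain m h where *: "m \<in> positive" "h \<in> positive" "g + m = gen_F (Suc i) + h"
      using gen(2) by blast
    have "gen_F j + g + m = gen_F i + (gen_F j + h)"
      using * gen_F_rel[OF 3] by (simp add: add.assoc) (simp add: add.assoc[symmetric])
    then show ?thesis using * by (blast intro: positive_add positive_gen)
  qed
qed

text \<open>An inverse generator in front of \<open>g\<close> is absorbed by a common right multiple
  of the positive element \<open>g + m\<close> and x_i, from which x_i then cancels.\<close>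

lemma positive_denominator: "\<exists>m\<in>positive. g + m \<in> positive"
proof (induction g rule: thompson_group_induct)
  case zero
  then show ?case using positive_zero by force
next
  case (gen i g)
  then show ?case by (metis add.assoc positive_add positive_gen)
next
  case (inverse_gen i g)
  then obtain m where m: "m \<in> positive" "g + m \<in> positive" by blast
  obtain m' h where h: "m' \<in> positive" "h \<in> positive" "g + m + m' = gen_F i + h"
    using positive_common_right_multiple[OF m(2)] by blast
  have "- gen_F i + g + (m + m') = - gen_F i + (g + m + m')"
    by (simp add: add.assoc)
  also have "\<dots> = h" unfolding h(3) by (simp add: add.assoc[symmetric])
  finally show ?case using m h by (metis positive_add)
qed

lemma positive_common_denominator:
  assumes "finite A"
  shows "\<exists>m\<in>positive. \<forall>g\<in>A. g + m \<in> positive"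
  using assms
proof induction
  case empty
  then show ?case using positive_zero by blast
next
  case (insert g A)
  then obtain m where m: "m \<in> positive" "\<forall>g\<in>A. g + m \<in> positive" by blast
  obtain m' where "m' \<in> positive" "(g + m) + m' \<in> positive"
    using positive_denominator by blast
  with m show ?case
    by (intro bexI[of _ "m + m'"]) (auto simp: add.assoc[symmetric] intro: positive_add)
qed


section \<open>Injectivity of the shift on positive elements\<close>

text \<open>A form of the standard piecewise linear action of F, spread over the whole line. The map
  of x_i moves exactly the points beyond i, which makes smallest letters detectable, and unit
  translation conjugates it to the map of x_{i+1}.\<close>

definition pl_map :: "nat \<Rightarrow> real \<Rightarrow> real" where
  "pl_map i t = (if t \<le> real i then t else if t \<le> real i + 2 then (real i + t) / 2 else t - 1)"

definition pl_map_inv :: "nat \<Rightarrow> real \<Rightarrow> real" where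
  "pl_map_inv i t = (if t \<le> real i then t else if t \<le> real i + 1 then 2 * t - real i else t + 1)"

lemma pl_map_inverse: "pl_map_inv i (pl_map i t) = t" "pl_map i (pl_map_inv i t) = t"
  unfolding pl_map_def pl_map_inv_def by (auto simp: field_simps)

lemma pl_map_rel:
  assumes "i < j"
  shows "pl_map j (pl_map i t) = pl_map i (pl_map (Suc j) t)"
proof -
  have ij: "real i + 1 \<le> real j" using assms by linarith
  \<comment> \<open>The cut points are the breakpoints i, i + 2 of x_i and j + 1, j + 3 of x_{j+1}.
    From i + 2 on, x_i acts as t - 1, so the breakpoints j, j + 2 of x_j pull back to the second
    pair.\<close>
  consider "t \<le> real i" | "real i < t" "t \<le> real i + 2" | "real i + 2 < t" "t \<le> real j + 1"
    | "real j + 1 < t" "t \<le> real j + 3" | "real j + 3 < t"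
    by linarith
  then show ?thesis
    by cases (use ij in \<open>simp_all add: pl_map_def field_simps\<close>)
qed

lemma pl_map_le: "pl_map i t \<le> t"
  by (auto simp: pl_map_def)

lemma pl_map_less: "real i < t \<Longrightarrow> pl_map i t < t"
  by (auto simp: pl_map_def)

lift_definition pl_action :: "thompson_group \<Rightarrow> real \<Rightarrow> real"
  is "foldr (\<lambda>(i, b). if b then pl_map i else pl_map_inv i)"
proof -
  let ?f = "foldr (\<lambda>(i, b). if b then pl_map i else pl_map_inv i)"
  fix v w
  assume "pres_eq thompson_group_rel v w"
  then show "?f v = ?f w"
  proof induction
    case (pres_rel v w)
    then show ?case
    proof cases
      case (group_rel v' w')
      from group_rel(3) obtain i j where "i < j" "v' = [j, i]" "w' = [i, Suc j]"
        by cases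
      then show ?thesis using group_rel by (auto simp: pl_map_rel)
    next
      case (group_cancel i b)
      then show ?thesis by (cases b) (auto simp: pl_map_inverse)
    qed
  qed auto
qed

lemma pl_action_zero [simp]: "pl_action 0 t = t"
  by transfer simp

lemma pl_action_plus [simp]: "pl_action (g + h) t = pl_action g (pl_action h t)"
  by transfer simp

lemma pl_action_gen [simp]: "pl_action (gen_F i) t = pl_map i t"
  by transfer simp

text \<open>Unit translation conjugates the action of each generator to that of the next one, so
  \<open>shift_F g\<close> determines how \<open>g\<close> acts.\<close>

lemma pl_action_shift: "pl_action (shift_F g) (t + 1) = pl_action g t + 1"
proof (transfer fixing: t)
  fix w :: "(nat \<times> bool) list"
  have "pl_map (Suc i) (s + 1) = pl_map i s + 1" "pl_map_inv (Suc i) (s + 1) = pl_map_inv i s + 1"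
    for i s by (auto simp: pl_map_def pl_map_inv_def field_simps)
  then show "foldr (\<lambda>(i, b). if b then pl_map i else pl_map_inv i) (map (\<lambda>(i, b). (Suc i, b)) w) (t + 1) =
        foldr (\<lambda>(i, b). if b then pl_map i else pl_map_inv i) w t + 1"
    by (induction w) auto
qed

section \<open>Sorted words as normal forms of positive elements\<close>

abbreviation gen_prod :: "nat list \<Rightarrow> thompson_group" where
  "gen_prod w \<equiv> sum_list (map gen_F w)"

text \<open>Insertion sort: x_i passes a smaller letter x_l by x_i x_l = x_l x_{i+1}. The clause on
  lower bounds is carried through the induction to see that \<open>l # v'\<close> is again
  sorted.\<close>

lemma sorted_insert_gen:
  assumes "sorted v"
  shows "\<exists>v'. sorted v' \<and> gen_F i + gen_prod v = gen_prod v' \<and>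
    (\<forall>j\<le>i. (\<forall>k\<in>set v. j \<le> k) \<longrightarrow> (\<forall>k\<in>set v'. j \<le> k))"
  using assms
proof (induction v arbitrary: i)
  case Nil
  then show ?case by (intro exI[of _ "[i]"]) auto
next
  case (Cons l v)
  show ?case
  proof (cases "i \<le> l")
    case True
    with Cons show ?thesis by (intro exI[of _ "i # l # v"]) auto
  next
    case False
    have v: "sorted v" "\<forall>k\<in>set v. l \<le> k" using Cons(2) by auto
    obtain v' where v': "sorted v'" "gen_F (Suc i) + gen_prod v = gen_prod v'"
      and le: "\<And>j. j \<le> Suc i \<Longrightarrow> \<forall>k\<in>set v. j \<le> k \<Longrightarrow> \<forall>k\<in>set v'. j \<le> k"
      using Cons(1)[OF v(1), of "Suc i"] by blast
    have "gen_F i + gen_prod (l # v) = gen_prod (l # v')"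
      using gen_F_rel[of l i] False v'(2)[symmetric] by (simp add: add.assoc[symmetric])
    moreover have "sorted (l # v')"
      using v'(1) le[OF _ v(2)] False by simp
    moreover have "\<forall>k\<in>set (l # v'). j \<le> k" if "j \<le> i" "\<forall>k\<in>set (l # v). j \<le> k" for j
      using le[of j] that by simp
    ultimately show ?thesis by blast
  qed
qed

lemma positive_sorted:
  assumes "g \<in> positive"
  obtains w where "sorted w" "g = gen_prod w"
proof -
  have "\<exists>w. sorted w \<and> g = gen_prod w"
    using assms
  proof (induction rule: positive_induct)
    case zero
    then show ?case by (intro exI[of _ "[]"]) auto
  next
    case (gen i h)
    then show ?case using sorted_insert_gen by metis
  qed
  then show ?thesis using that by blast
qed

lemma pl_action_gen_prod_le: "pl_action (gen_prod w) t \<le> t"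
  by (induction w) (auto intro: order_trans[OF pl_map_le])

lemma pl_action_gen_prod_fix:
  assumes "\<And>k. k \<in> set w \<Longrightarrow> t \<le> real k"
  shows "pl_action (gen_prod w) t = t"
  using assms by (induction w) (auto simp: pl_map_def)

text \<open>Positive words never move a point to the right. Either \<open>w\<close> already moves t
  to the left, or it fixes t and x_i moves it.\<close>

lemma pl_action_gen_prod_less:
  assumes "real i < t"
  shows "pl_action (gen_prod (i # w)) t < t"
proof (cases "pl_action (gen_prod w) t = t")
  case True
  then show ?thesis using pl_map_less[OF assms] by simp
next
  case False
  then show ?thesis
    using pl_action_gen_prod_le[of w t] pl_map_le[of i "pl_action (gen_prod w) t"] by simp
qed

text \<open>The smallest letter of a sorted word is the supremum of the points below which the word acts
  trivially.\<close>

lemma sorted_pl_action_inj: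
  assumes "sorted v" "sorted w" "pl_action (gen_prod v) = pl_action (gen_prod w)"
  shows "v = w"
  using assms
proof (induction v arbitrary: w)
  case Nil
  show ?case
  proof (cases w)
    case (Cons j w')
    then show ?thesis
      using fun_cong[OF Nil(3), of "real j + 1"] pl_action_gen_prod_less[of j "real j + 1" w'] by simp
  qed simp
next
  case (Cons i v)
  obtain j w' where w: "w = j # w'"
    using fun_cong[OF Cons(4), of "real i + 1"] pl_action_gen_prod_less[of i "real i + 1" v]
    by (cases w) auto
  have "\<not> i < j"
  proof
    assume "i < j"
    then have "pl_action (gen_prod w) (real j) = real j"
      using Cons(3) w by (intro pl_action_gen_prod_fix) auto
    then show False
      using pl_action_gen_prod_less[of i "real j" v] fun_cong[OF Cons(4), of "real j"] \<open>i < j\<close> by simp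
  qed
  moreover have "\<not> j < i"
  proof
    assume "j < i"
    then have "pl_action (gen_prod (i # v)) (real i) = real i"
      using Cons(2) by (intro pl_action_gen_prod_fix) auto
    then show False
      using pl_action_gen_prod_less[of j "real i" w'] fun_cong[OF Cons(4), of "real i"] \<open>j < i\<close> w by simp
  qed
  ultimately have ij: "i = j" by simp
  have "pl_action (gen_prod v) t = pl_action (gen_prod w') t" for t
    using fun_cong[OF Cons(4), of t] w ij by simp (metis pl_map_inverse(1))
  then have "v = w'"
    using Cons w by auto
  then show ?case using ij w by simp
qed

text \<open>The shifts of g and h determine the actions of g and h, and the action separates the
  sorted words that represent positive elements.\<close>

lemma inj_on_shift_F: "inj_on shift_F positive"
proof
  fix g h
  assume gh: "g \<in> positive" "h \<in> positive" "shift_F g = shift_F h"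
  have "pl_action g t = pl_action h t" for t
    using pl_action_shift[of g t] pl_action_shift[of h t] gh(3) by simp
  with gh(1,2) show "g = h"
    by (metis ext positive_sorted sorted_pl_action_inj)
qed


section \<open>Homomorphisms to the integers\<close>

text \<open>Since \<open>i < j\<close> forces \<open>j \<ge> 1\<close> in the defining relations, sending \<open>x\<^sub>0\<close> to \<open>1\<close> and all other
  generators to a fixed \<open>c\<close> is a homomorphism.  On positive elements it counts
  the letters \<open>x\<^sub>0\<close> if \<open>c = 0\<close> and is the length if \<open>c = 1\<close>.\<close>

lift_definition weight :: "int \<Rightarrow> thompson_group \<Rightarrow> int"
  is "\<lambda>c w. \<Sum>(i, b)\<leftarrow>w. (if b then 1 else - 1) * (if i = 0 then 1 else c)"
proof -
  let ?f = "\<lambda>c w. \<Sum>(i, b)\<leftarrow>w. (if b then 1 else - 1) * (if i = (0::nat) then 1 else c::int)"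
  fix c v w
  assume "pres_eq thompson_group_rel v w"
  then show "?f c v = ?f c w"
  proof induction
    case (pres_rel v w)
    then show ?case
    proof cases
      case (group_rel v' w')
      from group_rel(3) obtain i j where "i < j" "v' = [j, i]" "w' = [i, Suc j]"
        by cases
      then show ?thesis using group_rel by auto
    qed auto
  qed auto
qed

lemma weight_zero [simp]: "weight c 0 = 0"
  by transfer simp

lemma weight_plus [simp]: "weight c (g + h) = weight c g + weight c h"
  by transfer simp

lemma weight_gen [simp]: "weight c (gen_F i) = (if i = 0 then 1 else c)"
  by transfer simp

lemma weight_minus [simp]: "weight c (- g) = - weight c g"
  using weight_plus[of c g "- g"] by simp

lemma weight_shift_F:
  "weight 0 (shift_F g) = 0" "weight 1 (shift_F g) = weight 1 g"
  by (induction g rule: thompson_group_induct) (auto simp: shift_F_minus)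

lemma weight_positive_nonneg:
  assumes "0 \<le> c" "g \<in> positive"
  shows "0 \<le> weight c g"
  using assms(2) by (induction rule: positive_induct) (use assms(1) in auto)


section \<open>The group ring\<close>

lemma lookup_single_mult:
  fixes a :: "'k::field thompson_ring"
  shows "Poly_Mapping.lookup (Poly_Mapping.single h c * a) g = c * Poly_Mapping.lookup a (- h + g)"
proof -
  have eq: "h + g' = g \<longleftrightarrow> g' = - h + g" for g'
    by (metis add.assoc add.left_neutral left_minus right_minus)
  have "Poly_Mapping.single h c * a =
      (\<Sum>g'\<in>Poly_Mapping.keys a. Poly_Mapping.single (h + g') (c * Poly_Mapping.lookup a g'))"
    by (subst poly_mapping_eq_sum_single[of a]) (simp add: sum_distrib_left mult_single)
  then show ?thesis
    by (simp add: lookup_sum lookup_single when_def eq sum.delta in_keys_iff)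
qed

lemma keys_single_mult:
  fixes a :: "'k::field thompson_ring"
  shows "Poly_Mapping.keys (Poly_Mapping.single h 1 * a) = (+) h ` Poly_Mapping.keys a"
proof -
  have "x \<in> (+) h ` A \<longleftrightarrow> - h + x \<in> A" for x A
    by (metis (no_types, lifting) add.assoc add.left_neutral image_iff left_minus right_minus)
  then show ?thesis
    by (auto simp: in_keys_iff lookup_single_mult)
qed

lemma lookup_X_mult:
  "Poly_Mapping.lookup (X i * a) g = Poly_Mapping.lookup a (- gen_F i + g)"
  by (simp add: X_def lookup_single_mult)

lemma keys_X_mult: "Poly_Mapping.keys (X i * a) = (+) (gen_F i) ` Poly_Mapping.keys a"
  by (simp add: X_def keys_single_mult)

lemma X_mult_cancel:
  assumes "X i * a = X i * b"
  shows "a = b"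
proof -
  have "Poly_Mapping.single (- gen_F i) 1 * (X i * c) = c" for c :: "'a thompson_ring"
    by (simp add: X_def mult_single mult.assoc[symmetric])
  then show ?thesis using assms by metis
qed

lemma X_rel: "i < j \<Longrightarrow> X j * X i = X i * X (Suc j)"
  by (simp add: X_def mult_single gen_F_rel)

section \<open>The monoid ring K[M] inside K[F]\<close>

abbreviation KM :: "'k::field thompson_ring set" where
  "KM \<equiv> monoid_subring UNIV"

lemma KM_iff: "a \<in> KM \<longleftrightarrow> Poly_Mapping.keys a \<subseteq> positive"
  by (simp add: monoid_subring_def)

lemma KM_zero: "0 \<in> KM" and KM_one: "1 \<in> KM" and KM_X: "X i \<in> KM"
  by (auto simp: KM_iff X_def intro: positive_zero positive_gen)

lemma KM_add: "a \<in> KM \<Longrightarrow> b \<in> KM \<Longrightarrow> a + b \<in> KM"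
  using keys_add[of a b] by (auto simp: KM_iff)

lemma KM_diff: "a \<in> KM \<Longrightarrow> b \<in> KM \<Longrightarrow> a - b \<in> KM"
  using keys_diff[of a b] by (auto simp: KM_iff)

lemma KM_minus: "a \<in> KM \<Longrightarrow> - a \<in> KM"
  using KM_diff[OF KM_zero, of a] by simp

lemma KM_mult: "a \<in> KM \<Longrightarrow> b \<in> KM \<Longrightarrow> a * b \<in> KM"
  using keys_mult[of a b] unfolding KM_iff by (blast intro: positive_add)

lemmas KM_intros = KM_zero KM_one KM_X KM_add KM_diff KM_minus KM_mult

definition restr :: "thompson_group set \<Rightarrow> 'k::field thompson_ring \<Rightarrow> 'k thompson_ring" where
  "restr S a = (\<Sum>g\<in>Poly_Mapping.keys a \<inter> S. Poly_Mapping.single g (Poly_Mapping.lookup a g))"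

lemma lookup_restr: "Poly_Mapping.lookup (restr S a) g = (Poly_Mapping.lookup a g when g \<in> S)"
  by (auto simp: restr_def lookup_sum lookup_single when_def sum.delta in_keys_iff)

lemma keys_restr: "Poly_Mapping.keys (restr S a) = Poly_Mapping.keys a \<inter> S"
  by (auto simp: in_keys_iff lookup_restr when_def split: if_splits)

lemma restr_restr: "restr S (restr S a) = restr S a"
  by (rule poly_mapping_eqI) (simp add: lookup_restr when_def)

lemma keys_diff_restr: "Poly_Mapping.keys (a - restr S a) = Poly_Mapping.keys a - S"
  by (auto simp: in_keys_iff lookup_minus lookup_restr when_def split: if_splits)

lemma KM_restr: "a \<in> KM \<Longrightarrow> restr S a \<in> KM"
  by (auto simp: KM_iff keys_restr)

text \<open>Homogeneous component of degree n for the grading of K[F] in which x_0 has degree 1 and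
  every other generator degree 0.\<close>

abbreviation comp :: "int \<Rightarrow> 'k::field thompson_ring \<Rightarrow> 'k thompson_ring" where
  "comp n \<equiv> restr {g. weight 0 g = n}"

lemma comp_diff: "comp n (a - b) = comp n a - comp n b"
  by (rule poly_mapping_eqI) (simp add: lookup_restr lookup_minus when_def)

lemma comp_X_mult: "comp n (X i * a) = X i * comp (n - (if i = 0 then 1 else 0)) a"
  by (rule poly_mapping_eqI) (auto simp: lookup_restr lookup_X_mult when_def)

text \<open>Left multiplication by \<open>X 0\<close> raises the degree by one and
  \<open>X 1\<close> preserves it, so the equation splits into its degrees.\<close>

lemma comp_equation:
  assumes "(1 - X 0) * u = (1 - X 1) * v"
  shows "comp n u - X 0 * comp (n - 1) u = (1 - X 1) * comp n v"
  using arg_cong[OF assms, of "comp n"]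
  by (simp add: left_diff_distrib comp_diff comp_X_mult)

text \<open>On K[M] this bounds the x_0-degree for c = 0 and the length for c = 1. The bound is
  strict so that bound 0 forces the zero element of K[M], where the induction on length
  starts.\<close>

definition weight_below :: "int \<Rightarrow> int \<Rightarrow> 'k::field thompson_ring \<Rightarrow> bool" where
  "weight_below c n a \<longleftrightarrow> (\<forall>g\<in>Poly_Mapping.keys a. weight c g < n)"

lemma weight_below_diff: "weight_below c n a \<Longrightarrow> weight_below c n b \<Longrightarrow> weight_below c n (a - b)"
  using keys_diff[of a b] by (auto simp: weight_below_def)

lemma weight_below_X_mult:
  "weight_below c n (X i * a) \<longleftrightarrow> weight_below c (n - (if i = 0 then 1 else c)) a"
  by (auto simp: weight_below_def keys_X_mult)

lemma weight_below_mono: "weight_below c m a \<Longrightarrow> m \<le> n \<Longrightarrow> weight_below c n a"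
  by (force simp: weight_below_def)

lemma weight_below_one_minus_X_mult:
  assumes "weight_below c n a" "0 \<le> c" "i \<noteq> 0"
  shows "weight_below c (n + c) ((1 - X i) * a)"
proof -
  have "weight_below c (n + c) a"
    using assms by (auto intro: weight_below_mono)
  then show ?thesis
    using assms by (auto simp: left_diff_distrib weight_below_X_mult intro: weight_below_diff)
qed

text \<open>If g has maximal length in the support of a, then x_i g is too long to lie in that
  support, so its coefficient in (1 - x_i) a is minus that of g and does not vanish.\<close>

lemma weight_below_cancel:
  assumes "weight_below 1 (n + 1) ((1 - X i) * a)"
  shows "weight_below 1 n a"
proof (rule ccontr)
  assume "\<not> weight_below 1 n a"
  then obtain g0 where g0: "g0 \<in> Poly_Mapping.keys a" "n \<le> weight 1 g0"
    by (auto simp: weight_below_def not_less)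
  let ?W = "weight 1 ` Poly_Mapping.keys a"
  have "Max ?W \<in> ?W" using g0 by (intro Max_in) auto
  then obtain g where g: "g \<in> Poly_Mapping.keys a" "weight 1 g = Max ?W" by auto
  then have g: "g \<in> Poly_Mapping.keys a" "\<And>h. h \<in> Poly_Mapping.keys a \<Longrightarrow> weight 1 h \<le> weight 1 g"
    by auto
  have "gen_F i + g \<notin> Poly_Mapping.keys a"
    using g(2)[of "gen_F i + g"] by auto
  then have "Poly_Mapping.lookup ((1 - X i) * a) (gen_F i + g) = - Poly_Mapping.lookup a g"
    by (simp add: left_diff_distrib lookup_minus lookup_X_mult in_keys_iff add.assoc[symmetric])
  then have "gen_F i + g \<in> Poly_Mapping.keys ((1 - X i) * a)"
    using g(1) by (simp add: in_keys_iff)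
  then have "weight 1 g < n"
    using assms by (auto simp: weight_below_def)
  then show False using g(2)[OF g0(1)] g0(2) by simp
qed

lemma comp_eq_zero: "weight_below 0 n a \<Longrightarrow> n \<le> m \<Longrightarrow> comp m a = 0"
  by (rule poly_mapping_eqI) (force simp: lookup_restr when_def weight_below_def in_keys_iff)

lemma KM_weight_below_zero:
  assumes "0 \<le> c" "a \<in> KM" "weight_below c 0 a"
  shows "a = 0"
proof -
  have "Poly_Mapping.keys a = {}"
    using assms weight_positive_nonneg[OF assms(1)] unfolding KM_iff weight_below_def
    by (metis equals0I linorder_not_less subset_iff)
  then show ?thesis by simp
qed

text \<open>A positive element of positive x_0-degree is no shift, so by
  \<open>positive_cases\<close> it begins with x_0. The division by x_0 takes place in K[F]; the
  support of the quotient is then seen to be positive.\<close>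

lemma comp_factor:
  assumes "a \<in> KM" "0 < n"
  obtains b where "b \<in> KM" "comp n a = X 0 * b" "comp (n - 1) b = b"
proof -
  define b where "b = Poly_Mapping.single (- gen_F 0) 1 * comp n a"
  have eq: "comp n a = X 0 * b"
    by (simp add: b_def X_def mult_single mult.assoc[symmetric])
  have keys: "Poly_Mapping.keys b = (+) (- gen_F 0) ` (Poly_Mapping.keys a \<inter> {g. weight 0 g = n})"
    by (simp add: b_def keys_single_mult keys_restr)
  have "b \<in> KM"
    unfolding KM_iff keys
  proof (rule image_subsetI)
    fix g assume "g \<in> Poly_Mapping.keys a \<inter> {g. weight 0 g = n}"
    then have "g \<in> positive" "weight 0 g \<noteq> 0" using assms by (auto simp: KM_iff)
    then show "- gen_F 0 + g \<in> positive"
      by (cases rule: positive_cases) (auto simp: weight_shift_F add.assoc[symmetric])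
  qed
  moreover have "comp (n - 1) b = b"
  proof (rule X_mult_cancel)
    have "X 0 * comp (n - 1) b = comp n (X 0 * b)"
      by (simp add: comp_X_mult)
    also have "\<dots> = X 0 * b"
      by (simp only: eq[symmetric] restr_restr)
    finally show "X 0 * comp (n - 1) b = X 0 * b" .
  qed
  ultimately show ?thesis using that eq by blast
qed


section \<open>Shifts\<close>

text \<open>Since the shift is injective on positive elements, no two coefficients of a are
  merged.\<close>

lemma lookup_shift_KF:
  assumes "a \<in> KM" "g \<in> positive"
  shows "Poly_Mapping.lookup (shift_KF a) (shift_F g) = Poly_Mapping.lookup a g"
proof -
  have "Poly_Mapping.lookup (shift_KF a) (shift_F g) =
      (\<Sum>h\<in>Poly_Mapping.keys a. Poly_Mapping.lookup a h when h = g)"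
    unfolding shift_KF_def lookup_sum
  proof (rule sum.cong[OF refl])
    fix h assume "h \<in> Poly_Mapping.keys a"
    then have "shift_F h = shift_F g \<longleftrightarrow> h = g"
      using assms inj_on_eq_iff[OF inj_on_shift_F] by (auto simp: KM_iff)
    then show "Poly_Mapping.lookup (Poly_Mapping.single (shift_F h) (Poly_Mapping.lookup a h)) (shift_F g) =
        (Poly_Mapping.lookup a h when h = g)"
      by (simp add: lookup_single when_def)
  qed
  then show ?thesis
    by (simp add: when_def sum.delta in_keys_iff)
qed

lemma keys_shift_KF_subset: "Poly_Mapping.keys (shift_KF a) \<subseteq> shift_F ` Poly_Mapping.keys a"
  unfolding shift_KF_def by (rule order_trans[OF keys_sum]) auto

lemma shift_KF_minus: "shift_KF (- a) = - shift_KF a"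
  using shift_KF_diff[of 0 a] by simp

lemma shift_KF_inj:
  assumes "a \<in> KM" "b \<in> KM" "shift_KF a = shift_KF b"
  shows "a = b"
proof (rule poly_mapping_eqI)
  fix g
  show "Poly_Mapping.lookup a g = Poly_Mapping.lookup b g"
  proof (cases "g \<in> positive")
    case True
    then show ?thesis using lookup_shift_KF assms by metis
  next
    case False
    then have "g \<notin> Poly_Mapping.keys a" "g \<notin> Poly_Mapping.keys b"
      using assms(1,2) by (auto simp: KM_iff)
    then show ?thesis by (simp add: in_keys_iff)
  qed
qed

lemma weight_below_shift_KF:
  assumes "a \<in> KM" "weight_below 1 n (shift_KF a)"
  shows "weight_below 1 n a"
  unfolding weight_below_def
proof
  fix g assume g: "g \<in> Poly_Mapping.keys a"
  then have "g \<in> positive" using assms(1) by (auto simp: KM_iff)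
  then have "shift_F g \<in> Poly_Mapping.keys (shift_KF a)"
    using g lookup_shift_KF[OF assms(1)] by (simp add: in_keys_iff)
  then show "weight 1 g < n"
    using assms(2) weight_shift_F(2)[of g] by (auto simp: weight_below_def)
qed

text \<open>Counterpart of \<open>comp_factor\<close>: a support element x_0 h with h positive would
  have degree at least 1, which leaves the shift case of \<open>positive_cases\<close>.\<close>

lemma comp_zero_unshift:
  assumes "a \<in> KM" "comp 0 a = a"
  obtains w where "w \<in> KM" "a = shift_KF w"
proof -
  have "\<exists>h\<in>positive. g = shift_F h" if "g \<in> Poly_Mapping.keys a" for g
  proof -
    have "g \<in> Poly_Mapping.keys (comp 0 a)" using that assms(2) by simp
    then have "weight 0 g = 0" by (simp add: keys_restr)
    have "g \<in> positive" using that assms(1) by (auto simp: KM_iff)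
    then show ?thesis
    proof (cases rule: positive_cases[consumes 1])
      case (1 h)
      then show ?thesis using \<open>weight 0 g = 0\<close> weight_positive_nonneg[of 0 h] by simp
    qed blast
  qed
  then obtain h where h: "\<And>g. g \<in> Poly_Mapping.keys a \<Longrightarrow> h g \<in> positive \<and> g = shift_F (h g)"
    by metis
  define w where "w = (\<Sum>g\<in>Poly_Mapping.keys a. Poly_Mapping.single (h g) (Poly_Mapping.lookup a g))"
  have "w \<in> KM"
    unfolding KM_iff w_def by (rule order_trans[OF keys_sum]) (use h in auto)
  moreover have "shift_KF w = (\<Sum>g\<in>Poly_Mapping.keys a. Poly_Mapping.single g (Poly_Mapping.lookup a g))"
    unfolding w_def shift_KF_sum by (rule sum.cong) (use h in auto)
  ultimately show ?thesis
    using that poly_mapping_eq_sum_single by metis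
qed

text \<open>The elements of M whose shift lies in the image of M_{i+1} form a submonoid containing
  the generators of M_i, hence all of M_i.\<close>

lemma shift_tail_submonoid:
  assumes "m \<in> tail_submonoid i"
  shows "shift_F (embed_MF m) \<in> embed_MF ` tail_submonoid (Suc i)"
proof -
  let ?T = "embed_MF ` tail_submonoid (Suc i)"
  have sub: "submonoid (tail_submonoid (Suc i))"
    unfolding tail_submonoid_def by (rule hull_in) (auto simp: submonoid_def)
  have "0 \<in> ?T"
    using sub by (metis embed_MF_zero image_eqI submonoid_def)
  moreover have "a + b \<in> ?T" if "a \<in> ?T" "b \<in> ?T" for a b
    using that sub by (auto simp: submonoid_def) (metis embed_MF_plus image_eqI)
  ultimately have "submonoid {m. shift_F (embed_MF m) \<in> ?T}"
    by (auto simp: submonoid_def)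
  moreover have "shift_F (embed_MF (gen_M j)) \<in> ?T" if "i \<le> j" for j
  proof -
    have "gen_M (Suc j) \<in> tail_submonoid (Suc i)"
      unfolding tail_submonoid_def using that by (intro hull_inc) auto
    then show ?thesis by (metis embed_MF_gen image_eqI shift_F_gen)
  qed
  ultimately have "tail_submonoid i \<subseteq> {m. shift_F (embed_MF m) \<in> ?T}"
    unfolding tail_submonoid_def by (intro hull_minimal) auto
  then show ?thesis using assms by blast
qed

lemma shift_KF_tail:
  assumes "a \<in> monoid_subring (tail_submonoid i)"
  shows "shift_KF a \<in> monoid_subring (tail_submonoid (Suc i))"
  using assms keys_shift_KF_subset[of a] shift_tail_submonoid[of _ i]
  unfolding monoid_subring_def by blast

lemma tail_submonoid_zero: "tail_submonoid 0 = UNIV"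
proof -
  have sub: "submonoid (tail_submonoid 0)"
    unfolding tail_submonoid_def by (rule hull_in) (auto simp: submonoid_def)
  have "m \<in> tail_submonoid 0" for m
  proof (induction m rule: thompson_monoid_induct)
    case (2 i m)
    have "gen_M i \<in> tail_submonoid 0"
      unfolding tail_submonoid_def by (intro hull_inc) auto
    then show ?case using 2 sub by (auto simp: submonoid_def)
  qed (use sub in \<open>auto simp: submonoid_def\<close>)
  then show ?thesis by blast
qed


section \<open>Solutions of the equation\<close>

lemma X_rel_left: "i < j \<Longrightarrow> X j * (X i * a) = X i * (X (Suc j) * a)"
  by (metis X_rel mult.assoc)

text \<open>Subtracting right multiples of u_0 therefore preserves solutions. The products match
  because x_1 x_0 x_0 = x_0 x_0 x_3 and x_1 x_0 x_1 = x_0 x_1 x_3.\<close>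

lemma u_elem_zero_solution:
  "(1 - X 0) * u_elem 0 = (1 - X 1) * (1 - X 3 - X 0 * X 0 + X 0 * X 1)"
  by (simp add: ring_distribs mult.assoc X_rel X_rel_left numeral_eq_Suc)

text \<open>Each round removes the leading x_0-component of u by a multiple of u_0. The length bound
  d is carried along for the later induction on length.\<close>

lemma eliminate_X0:
  assumes "u \<in> KM" "v \<in> KM" "(1 - X 0) * u = (1 - X 1) * v"
    and "weight_below 0 (int N + 1) u" "weight_below 1 d u"
  shows "\<exists>r\<in>KM. \<exists>u'\<in>KM. \<exists>v'\<in>KM. u = u_elem 0 * r + u' \<and> (1 - X 0) * u' = (1 - X 1) * v' \<and>
    weight_below 0 1 u' \<and> weight_below 1 d u'"
  using assms
proof (induction N arbitrary: u v)
  case 0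
  then show ?case
    by (intro bexI[of _ 0] bexI[of _ u] bexI[of _ v]) (auto simp: KM_zero)
next
  case (Suc N)
  let ?n = "int (Suc N)"
  have "comp (?n + 1) u = 0"
    using Suc.prems(4) by (auto intro: comp_eq_zero)
  then have top: "- (X 0 * comp ?n u) = (1 - X 1) * comp (?n + 1) v"
    using comp_equation[OF Suc.prems(3), of "?n + 1"] by simp
  \<comment> \<open>This component of v has degree at least 2, so two factors x_0 split off; 1 - x_1
    passes them as (1 - x_1) x_0 x_0 = x_0 x_0 (1 - x_3).\<close>
  obtain b where b: "b \<in> KM" "comp (?n + 1) v = X 0 * b" "comp ?n b = b"
    using comp_factor[OF Suc.prems(2), of "?n + 1"] by auto
  obtain b' where b': "b' \<in> KM" "b = X 0 * b'" "comp (int N) b' = b'"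
    using comp_factor[OF b(1), of ?n] b(3) by auto
  define c where "c = - b'"
  have "(1 - X 1) * comp (?n + 1) v = X 0 * (X 0 * ((1 - X 3) * b'))"
    unfolding b(2) b'(2)
    by (simp add: ring_distribs mult.assoc X_rel X_rel_left numeral_eq_Suc)
  then have "X 0 * comp ?n u = X 0 * (X 0 * ((1 - X 3) * c))"
    using top by (simp add: c_def) (metis minus_minus)
  then have cu: "comp ?n u = X 0 * ((1 - X 3) * c)"
    by (rule X_mult_cancel)
  have c: "c \<in> KM" using b' by (simp add: c_def KM_intros)
  have "weight_below 0 (int N + 1) b'"
    by (subst b'(3)[symmetric]) (auto simp: weight_below_def keys_restr)
  then have c0: "weight_below 0 (int N + 1) c"
    by (simp add: c_def weight_below_def)
  have "weight_below 1 d (comp ?n u)"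
    using Suc.prems(5) by (simp add: weight_below_def keys_restr)
  then have "weight_below 1 (d - 2 + 1) ((1 - X 3) * c)"
    unfolding cu by (simp add: weight_below_X_mult)
  then have c1: "weight_below 1 (d - 2) c"
    by (rule weight_below_cancel)
  define u' where "u' = u - u_elem 0 * c"
  define v' where "v' = v - (1 - X 3 - X 0 * X 0 + X 0 * X 1) * c"
  \<comment> \<open>Split u_0 = x_0 (1 - x_3) + (1 - x_1)(1 - x_3): the first summand times c is the
    leading component of u, and the second times c has only the degrees of c, which are
    lower.\<close>
  have u': "u' = (u - comp ?n u) - (1 - X 1) * ((1 - X 3) * c)"
    unfolding cu u'_def by (simp add: algebra_simps)
  have "u' \<in> KM" "v' \<in> KM"
    unfolding u'_def v'_def u_elem.simps using Suc.prems c by (auto intro!: KM_intros)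
  moreover have "(1 - X 0) * u' = (1 - X 1) * v'"
    unfolding u'_def v'_def right_diff_distrib Suc.prems(3) mult.assoc[symmetric] u_elem_zero_solution ..
  moreover have "weight_below 0 (int N + 1) u'"
  proof -
    have "weight_below 0 (int N + 1) (u - comp ?n u)"
      using Suc.prems(4) by (auto simp: weight_below_def keys_diff_restr less_le)
    then show ?thesis
      unfolding u' using weight_below_one_minus_X_mult[OF c0, of 3]
        weight_below_one_minus_X_mult[of 0 "int N + 1" _ 1]
      by (auto intro!: weight_below_diff)
  qed
  moreover have "weight_below 1 d u'"
  proof -
    have "weight_below 1 d (u - comp ?n u)"
      using Suc.prems(5) by (auto simp: weight_below_def keys_diff_restr less_le)
    then show ?thesis
      unfolding u' using weight_below_one_minus_X_mult[OF c1, of 3]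
        weight_below_one_minus_X_mult[of 1 "d - 1" _ 1]
      by (auto intro!: weight_below_diff)
  qed
  ultimately obtain r u'' v'' where *: "r \<in> KM" "u'' \<in> KM" "v'' \<in> KM" "u' = u_elem 0 * r + u''"
    "(1 - X 0) * u'' = (1 - X 1) * v''" "weight_below 0 1 u''" "weight_below 1 d u''"
    using Suc.IH by blast
  have "u = u_elem 0 * (c + r) + u''"
    using *(4) by (simp only: u'_def distrib_left) (simp only: algebra_simps)
  with * c show ?case by (blast intro: KM_add)
qed

text \<open>Degrees 0 and 1 of the equation give u in two ways, as (1 - x_1) phi(w) and as -(1 -
  x_2) phi(w'). Equating them and undoing phi yields the same equation for w and -w'. The factor 1 -
  x_1 accounts for one unit of length, so the bound for w drops by one.\<close>

lemma unshift_solution: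
  assumes "u \<in> KM" "v \<in> KM" "(1 - X 0) * u = (1 - X 1) * v"
    and "weight_below 0 1 u" "weight_below 1 (d + 1) u"
  obtains w w' where "w \<in> KM" "w' \<in> KM" "(1 - X 0) * w = (1 - X 1) * w'"
    "u = (1 - X 1) * shift_KF w" "weight_below 1 d w"
proof -
  \<comment> \<open>Degree 0 of the equation also involves this component; positive elements have no
    negative degree.\<close>
  have "comp (- 1) u = 0"
    using weight_positive_nonneg[of 0] assms(1)
    by (intro poly_mapping_eqI) (force simp: lookup_restr when_def KM_iff in_keys_iff)
  moreover have "comp 0 u = u"
    using weight_positive_nonneg[of 0] assms(1,4)
    by (intro poly_mapping_eqI) (force simp: lookup_restr when_def KM_iff in_keys_iff weight_below_def)
  moreover have "comp 1 u = 0"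
    using assms(4) by (auto intro: comp_eq_zero)
  ultimately have u: "u = (1 - X 1) * comp 0 v" and top: "- (X 0 * u) = (1 - X 1) * comp 1 v"
    using comp_equation[OF assms(3), of 0] comp_equation[OF assms(3), of 1] by simp_all
  obtain w where w: "w \<in> KM" "comp 0 v = shift_KF w"
    using comp_zero_unshift[OF KM_restr[OF assms(2)] restr_restr] by metis
  obtain b where b: "b \<in> KM" "comp 1 v = X 0 * b" "comp 0 b = b"
    using comp_factor[OF assms(2), of 1] by auto
  then obtain w' where w': "w' \<in> KM" "b = shift_KF w'"
    using comp_zero_unshift by metis
  have "X 0 * u = X 0 * ((1 - X 2) * - b)"
    using top unfolding b(2)
    by (simp add: ring_distribs mult.assoc X_rel X_rel_left numeral_eq_Suc) (simp add: algebra_simps)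
  then have u': "u = (1 - X 2) * - b"
    by (rule X_mult_cancel)
  have "shift_KF ((1 - X 0) * w) = (1 - X 1) * comp 0 v"
    by (simp add: shift_KF_mult shift_KF_diff w(2))
  moreover have "shift_KF ((1 - X 1) * - w') = (1 - X 2) * - b"
    by (simp add: shift_KF_mult shift_KF_diff shift_KF_minus w'(2) numeral_eq_Suc)
  ultimately have "shift_KF ((1 - X 0) * w) = shift_KF ((1 - X 1) * - w')"
    unfolding u[symmetric] u'[symmetric] by (rule trans[OF _ sym])
  then have "(1 - X 0) * w = (1 - X 1) * - w'"
    by (rule shift_KF_inj[rotated 2]) (use w(1) w'(1) in \<open>auto intro!: KM_intros\<close>)
  moreover have "u = (1 - X 1) * shift_KF w"
    using u unfolding w(2) .
  moreover from this have "weight_below 1 d w"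
    using assms(5) weight_below_shift_KF[OF w(1)] weight_below_cancel by blast
  ultimately show ?thesis
    using that w(1) KM_minus[OF w'(1)] by blast
qed

text \<open>After u_0 r_0 is split off, the rest is (1 - x_1) phi(w) with w a solution of smaller
  length bound. An expansion of w carries over since (1 - x_1) phi(u_i r_i) = u_{i+1}
  phi(r_i).\<close>

lemma KM_solution_bounded:
  assumes "u \<in> KM" "v \<in> KM" "(1 - X 0) * u = (1 - X 1) * v" "weight_below 1 (int d) u"
  shows "\<exists>(k::nat) r. (\<forall>i\<le>k. r i \<in> monoid_subring (tail_submonoid i)) \<and> u = (\<Sum>i\<le>k. u_elem i * r i)"
  using assms
proof (induction d arbitrary: u v)
  case 0
  then have "u = 0" using KM_weight_below_zero[of 1 u] by simp
  then show ?case
    by (intro exI[of _ 0] exI[of _ "\<lambda>_. 0"]) (auto simp: monoid_subring_def)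
next
  case (Suc d)
  \<comment> \<open>Inserting 0 covers u = 0 and makes the maximum nonnegative, so
    \<open>nat\<close> does not change it.\<close>
  let ?B = "Max (insert 0 (weight 0 ` Poly_Mapping.keys u))"
  have "weight_below 0 (int (nat ?B) + 1) u"
    by (auto simp: weight_below_def less_Suc_eq_le zless_add1_eq intro: Max_ge)
  then obtain r0 u' v' where r0: "r0 \<in> KM" "u' \<in> KM" "v' \<in> KM" "u = u_elem 0 * r0 + u'"
    "(1 - X 0) * u' = (1 - X 1) * v'" "weight_below 0 1 u'" "weight_below 1 (int d + 1) u'"
    using eliminate_X0[OF Suc.prems(1-3), of "nat ?B" "int d + 1"] Suc.prems(4)
    by (auto simp: add.commute)
  obtain w w' where w: "w \<in> KM" "w' \<in> KM" "(1 - X 0) * w = (1 - X 1) * w'"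
    "u' = (1 - X 1) * shift_KF w" "weight_below 1 (int d) w"
    by (rule unshift_solution[OF r0(2,3,5-7)])
  obtain k :: nat and r where r: "\<And>i. i \<le> k \<Longrightarrow> r i \<in> monoid_subring (tail_submonoid i)"
    "w = (\<Sum>i\<le>k. u_elem i * r i)"
    using Suc.IH[OF w(1-3,5)] by blast
  \<comment> \<open>The coefficient r_0 only has to lie in K[M] = K[M_0], and phi takes K[M_i] into
    K[M_{i+1}].\<close>
  let ?r = "case_nat r0 (\<lambda>i. shift_KF (r i))"
  have "u' = (\<Sum>i\<le>k. u_elem (Suc i) * shift_KF (r i))"
    unfolding w(4) r(2) by (simp add: shift_KF_sum shift_KF_mult sum_distrib_left mult.assoc)
  then have "u = (\<Sum>i\<le>Suc k. u_elem i * ?r i)"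
    by (simp only: r0(4) sum.atMost_Suc_shift nat.case)
  moreover have "\<forall>i\<le>Suc k. ?r i \<in> monoid_subring (tail_submonoid i)"
    using r0(1) r(1) shift_KF_tail by (auto simp: tail_submonoid_zero split: nat.split)
  ultimately show ?case by blast
qed

lemma KM_solution:
  assumes "u \<in> KM" "v \<in> KM" "(1 - X 0) * u = (1 - X 1) * v"
  shows "\<exists>(k::nat) r. (\<forall>i\<le>k. r i \<in> monoid_subring (tail_submonoid i)) \<and> u = (\<Sum>i\<le>k. u_elem i * r i)"
proof -
  let ?B = "Max (insert 0 (weight 1 ` Poly_Mapping.keys u))"
  have "weight_below 1 (int (nat (?B + 1))) u"
    by (auto simp: weight_below_def less_Suc_eq_le zless_add1_eq intro: Max_ge)
  then show ?thesis using KM_solution_bounded[OF assms] by blast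
qed

section \<open>Clearing denominators: from K[M] to K[F]\<close>

lemma KM_denominator:
  assumes "finite A"
  shows "\<exists>m. \<forall>a\<in>A. a * Poly_Mapping.single m (1::'k::field) \<in> KM"
proof -
  obtain m where m: "\<forall>g\<in>(\<Union>a\<in>A. Poly_Mapping.keys a). g + m \<in> positive"
    using positive_common_denominator[of "\<Union>a\<in>A. Poly_Mapping.keys a"] assms by auto
  have "a * Poly_Mapping.single m 1 \<in> KM" if "a \<in> A" for a
    using keys_mult[of a "Poly_Mapping.single m 1"] m that by (fastforce simp: KM_iff)
  then show ?thesis by blast
qed

lemma right_submodule_sum:
  assumes "right_submodule I" "finite A" "\<And>i. i \<in> A \<Longrightarrow> f i \<in> I"
  shows "(\<Sum>i\<in>A. f i) \<in> I"
  using assms(2,3) by induction (use assms(1) in \<open>auto simp: right_submodule_def\<close>)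

theorem theorem4:
  shows "(\<forall>u v :: 'k::field thompson_ring.
            (1 - X 0) * u = (1 - X 1) * v \<longrightarrow> u \<in> right_module_generated (range u_elem))
       \<and> (\<forall>u\<in>monoid_subring UNIV. \<forall>v\<in>monoid_subring UNIV.
            (1 - X 0) * u = (1 - X 1) * (v :: 'k thompson_ring) \<longrightarrow>
            (\<exists>(k::nat) r. (\<forall>i\<le>k. r i \<in> monoid_subring (tail_submonoid i))
                        \<and> u = (\<Sum>i\<le>k. u_elem i * r i)))"
proof (intro conjI allI ballI impI)
  fix u v :: "'k thompson_ring"
  assume eq: "(1 - X 0) * u = (1 - X 1) * v"
  \<comment> \<open>The unknowns stand on the right of the coefficients, so right multiplication by
    a common denominator m turns a solution into a solution in K[M].\<close>
  obtain m where m: "u * Poly_Mapping.single m 1 \<in> KM" "v * Poly_Mapping.single m 1 \<in> KM"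
    using KM_denominator[of "{u, v}"] by auto
  have "(1 - X 0) * (u * Poly_Mapping.single m 1) = (1 - X 1) * (v * Poly_Mapping.single m 1)"
    using eq by (simp add: mult.assoc[symmetric])
  then obtain k :: nat and r where r: "u * Poly_Mapping.single m 1 = (\<Sum>i\<le>k. u_elem i * r i)"
    using KM_solution[OF m] by blast
  \<comment> \<open>The element m is invertible in F, so u is recovered by a further right
    multiplication, under which right submodules are closed.\<close>
  have u: "u = (u * Poly_Mapping.single m 1) * Poly_Mapping.single (- m) 1"
    by (simp add: mult.assoc mult_single)
  show "u \<in> right_module_generated (range u_elem)"
    unfolding right_module_generated_def hull_def
  proof (intro InterI, clarify)
    fix I :: "'k thompson_ring set"
    assume I: "right_submodule I" "range u_elem \<subseteq> I"
    then have "u_elem i * r i \<in> I" for i by (metis range_subsetD right_submodule_def)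
    then have "(\<Sum>i\<le>k. u_elem i * r i) \<in> I"
      by (intro right_submodule_sum[OF I(1)]) auto
    then show "u \<in> I"
      using u r I(1) by (metis right_submodule_def)
  qed
next
  fix u v :: "'k thompson_ring"
  assume "u \<in> KM" "v \<in> KM" "(1 - X 0) * u = (1 - X 1) * v"
  then show "\<exists>(k::nat) r. (\<forall>i\<le>k. r i \<in> monoid_subring (tail_submonoid i)) \<and> u = (\<Sum>i\<le>k. u_elem i * r i)"
    by (rule KM_solution)
qed

end
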